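(* Let $m,n\ge 1$ be integers. The regions of $\mathcal{A}_n^{(m)}$ are in bijection with the decorated $m$-Dyck paths of size $n$. Explicitly, the following map is a bijection. Given a region, let $w_1\,0\,w_2$ be its word (its associated $m$-sketch). Reading $w_1$ from left to right, replace each letter of the form $\alpha_i^{(m)}$ with an up-step labeled $i$ and every other letter with a down-step. Then, reading $w_2$ from left to right, replace each letter of the form $\alpha_i^{(0)}$ with an up-step labeled $i$ and every other letter with a down-step. The resulting sequence of steps is a labeled $m$-Dyck path of size $n$, and the specified point on the $x$-axis is the point where the part of the path corresponding to $w_1$ ends.
   Context: $\mathcal{A}_n^{(m)}$ denotes the hyperplane arrangement in $\mathbb{R}^n$ given by $\{x_i=0 \mid i\in[n]\}\cup\{x_i=2^kx_j \mid k\in[-m,m],\ 1\le i<j\le n\}$ (so the parameter $a$ is taken to be $2$), where $[n]=\{1,\dots,n\}$ and $[p,q]$ denotes the set of integers from $p$ to $q$. A region is a connected component of the complement in $\mathbb{R}^n$ of the union of the hyperplanes. Word of a region: on a region of $\mathcal{A}_n^{(m)}$ the strict total order of the quantities $0$ and $2^kx_i$ ($i\in[n]$, $k\in[0,m]$) is constant. Writing these quantities in increasing order from left to right, with $2^kx_i$ represented by the symbol $\alpha_i^{(k)}$ and $0$ by the symbol $0$, gives a word in the symbols $\{0\}\cup\{\alpha_i^{(k)}\mid i\in[n],k\in[0,m]\}$, each used exactly once. It has the form $w_1\,0\,w_2$, where $w_1$ (resp. $w_2$) is the part of the word to the left (resp. right) of the symbol $0$. These words are called $m$-sketches of size $n$.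 A labeled $m$-Dyck path of size $n$ is a sequence of $(m+1)n$ terms in which $n$ terms are $+m$ (up-steps) and $mn$ terms are $-1$ (down-steps), the sum of any prefix is non-negative, and each $+m$ term is given a distinct label from $[n]$. It is drawn in $\mathbb{R}^2$ starting at $(0,0)$ by moving by $(1,m)$ for each up-step and by $(1,-1)$ for each down-step. A decorated $m$-Dyck path of size $n$ is a labeled $m$-Dyck path of size $n$ together with a choice of a point on the path that lies on the $x$-axis. *)

theory Defs
  imports "HOL-Analysis.Analysis"
begin

(* R^n is the space of (extensional) functions on {1..n} with the product topology,
   so that the coordinates and the labels are literally indexed by [n] = {1..n}. *)
abbreviation real_space :: "nat \<Rightarrow> (nat \<Rightarrow> real) topology" where
  "real_space n \<equiv> powertop_real {1..n}"

definition arrangement :: "nat \<Rightarrow> nat \<Rightarrow> (nat \<Rightarrow> real) set set" where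
  "arrangement m n =
     {{x \<in> topspace (real_space n). x i = 0} | i. i \<in> {1..n}} \<union>
     {{x \<in> topspace (real_space n). x i = 2 powi k * x j} | i j k.
        k \<in> {- int m..int m} \<and> 1 \<le> i \<and> i < j \<and> j \<le> n}"

definition regions :: "nat \<Rightarrow> nat \<Rightarrow> (nat \<Rightarrow> real) set set" where
  "regions m n =
     connected_components_of
       (subtopology (real_space n) (topspace (real_space n) - \<Union> (arrangement m n)))"

(* Alpha i k is the symbol alpha_i^(k). *)
datatype letter = Zero | Alpha nat nat

definition letters :: "nat \<Rightarrow> nat \<Rightarrow> letter set" where
  "letters m n = insert Zero {Alpha i k | i k. i \<in> {1..n} \<and> k \<in> {0..m}}"

fun letter_val :: "(nat \<Rightarrow> real) \<Rightarrow> letter \<Rightarrow> real" where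
  "letter_val x Zero = 0"
| "letter_val x (Alpha i k) = 2 ^ k * x i"

definition region_word :: "nat \<Rightarrow> nat \<Rightarrow> (nat \<Rightarrow> real) set \<Rightarrow> letter list" where
  "region_word m n R =
     (THE w. distinct w \<and> set w = letters m n \<and>
        (\<forall>x\<in>R. sorted_wrt (\<lambda>a b. letter_val x a < letter_val x b) w))"

(* The two parts of a word of the form w1 0 w2. *)
definition left_part :: "letter list \<Rightarrow> letter list" where
  "left_part w = takeWhile (\<lambda>a. a \<noteq> Zero) w"

definition right_part :: "letter list \<Rightarrow> letter list" where
  "right_part w = tl (dropWhile (\<lambda>a. a \<noteq> Zero) w)"

datatype step = is_Up: Up (label: nat) | is_Down: Down

fun rise :: "nat \<Rightarrow> step \<Rightarrow> int" where
  "rise m (Up i) = int m"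
| "rise m Down = - 1"

definition labeled_dyck_path :: "nat \<Rightarrow> nat \<Rightarrow> step list \<Rightarrow> bool" where
  "labeled_dyck_path m n p \<longleftrightarrow>
     length p = (m + 1) * n \<and>
     length (filter is_Up p) = n \<and>
     length (filter is_Down p) = m * n \<and>
     (\<forall>t\<le>length p. 0 \<le> (\<Sum>s\<leftarrow>take t p. rise m s)) \<and>
     distinct (map label (filter is_Up p)) \<and>
     set (map label (filter is_Up p)) \<subseteq> {1..n}"

(* The point of the plane reached after the first t steps. *)
definition vertex :: "nat \<Rightarrow> step list \<Rightarrow> nat \<Rightarrow> real \<times> real" where
  "vertex m p t = (real t, real_of_int (\<Sum>s\<leftarrow>take t p. rise m s))"

(* The path as drawn in the plane, i.e. the polygonal line through its vertices. *)
definition drawing :: "nat \<Rightarrow> step list \<Rightarrow> (real \<times> real) set" where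
  "drawing m p =
     insert (0, 0) (\<Union>t<length p. closed_segment (vertex m p t) (vertex m p (Suc t)))"

definition decorated_dyck_paths :: "nat \<Rightarrow> nat \<Rightarrow> (step list \<times> (real \<times> real)) set" where
  "decorated_dyck_paths m n =
     {(p, P). labeled_dyck_path m n p \<and> P \<in> drawing m p \<and> snd P = 0}"

(* Up-step at every alpha_i^(l): used with l = m on w1 and with l = 0 on w2. *)
fun letter_step :: "nat \<Rightarrow> letter \<Rightarrow> step" where
  "letter_step l (Alpha i k) = (if k = l then Up i else Down)"
| "letter_step l Zero = Down"

definition region_to_path :: "nat \<Rightarrow> nat \<Rightarrow> (nat \<Rightarrow> real) set \<Rightarrow> step list \<times> (real \<times> real)" where
  "region_to_path m n R =
     (let w = region_word m n R;
          p1 = map (letter_step m) (left_part w);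
          p2 = map (letter_step 0) (right_part w)
      in (p1 @ p2, vertex m (p1 @ p2) (length p1)))"

end

theory Submission imports Defs begin

text \<open>
  A region is the set of points at which the letters \<open>0\<close> and \<open>2 ^ k * x i\<close> have one prescribed
  strict order: the hyperplanes are the coincidences of two letters, and the set of points with a
  given order is open and convex. So regions correspond to the realizable words
  (\<open>bij_betw_region_word\<close>).

  Such a word splits at \<open>0\<close> into the letters of the negative and of the positive coordinates. After
  taking logarithms of absolute values, and reversing the index \<open>k\<close> on the negative side, both
  parts have the same shape: each label \<open>i\<close> contributes a ladder \<open>y i, y i + 1, \<dots>, y i + m\<close>, and the
  word lists the rungs of all ladders in increasing order (\<open>glue_in_sketches\<close>,
  \<open>sketches_imp_glue\<close>). The bottom rungs become the up-steps. Likewise a decorated path is cut at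
  its marked point into two Dyck paths with complementary label sets (\<open>decorated_dyck_paths_eq\<close>).

  It remains to show that ladder words correspond to Dyck paths. The height of the path counts the
  rungs owed by the ladders already started (\<open>height_eq_card_missing\<close>), so it is nonnegative and
  ends at \<open>0\<close>. As adding \<open>1\<close> preserves order, the owed rungs arrive first in, first out; hence the
  path determines the word (\<open>map_rung_step_inject\<close>). Reading a Dyck path by this rule, the
  position of each new ladder can be chosen between the last rung read and the next one owed, which
  realizes the path by a ladder word (\<open>dyck_on_imp_ladder_word\<close>).
\<close>

section \<open>Regions and words\<close>

abbreviation sketched_by :: "(nat \<Rightarrow> real) \<Rightarrow> letter list \<Rightarrow> bool" where
  "sketched_by x w \<equiv> sorted_wrt (\<lambda>a b. letter_val x a < letter_val x b) w"

definition cell :: "nat \<Rightarrow> letter list \<Rightarrow> (nat \<Rightarrow> real) set" where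
  "cell n w = {x \<in> topspace (real_space n). sketched_by x w}"

definition sketches :: "nat \<Rightarrow> nat \<Rightarrow> letter list set" where
  "sketches m n = {w. set w = letters m n \<and> cell n w \<noteq> {}}"

lemma finite_letters: "finite (letters m n)"
proof -
  have "{Alpha i k | i k. i \<in> {1..n} \<and> k \<in> {0..m}} = (\<lambda>(i, k). Alpha i k) ` ({1..n} \<times> {0..m})"
    by auto
  then show ?thesis by (simp add: letters_def)
qed

text \<open>The hyperplanes are exactly the coincidences between two letters: \<open>x i = 2 powi k * x j\<close>
  compares \<open>Alpha i 0\<close> with \<open>Alpha j (nat k)\<close> if \<open>k \<ge> 0\<close>, and \<open>Alpha i (nat (- k))\<close> with
  \<open>Alpha j 0\<close> otherwise.\<close>

lemma complement_arrangement:
  "topspace (real_space n) - \<Union> (arrangement m n) =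
     {x \<in> topspace (real_space n). inj_on (letter_val x) (letters m n)}"
proof (intro set_eqI iffI)
  fix x assume x: "x \<in> topspace (real_space n) - \<Union> (arrangement m n)"
  then have nz: "x i \<noteq> 0" if "i \<in> {1..n}" for i
    using that unfolding arrangement_def by blast
  have ne: "2 ^ k * x i \<noteq> 2 ^ l * x j" if ij: "i \<in> {1..n}" "j \<in> {1..n}" "i < j" and kl: "k \<le> m" "l \<le> m" for i j k l
  proof
    assume "2 ^ k * x i = 2 ^ l * x j"
    then have "x i = 2 powi (int l - int k) * x j"
      by (simp add: power_int_diff field_simps)
    moreover have "int l - int k \<in> {- int m..int m}" using kl by auto
    ultimately have "x \<in> {x \<in> topspace (real_space n). x i = 2 powi (int l - int k) * x j}"
      and "{x \<in> topspace (real_space n). x i = 2 powi (int l - int k) * x j} \<in> arrangement m n"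
      using x ij unfolding arrangement_def
      by (blast, intro UnI2 CollectI exI[of _ i] exI[of _ j] exI[of _ "int l - int k"]) simp
    then show False using x by blast
  qed
  have "inj_on (letter_val x) (letters m n)"
  proof (rule inj_onI)
    fix a b assume ab: "a \<in> letters m n" "b \<in> letters m n" "letter_val x a = letter_val x b"
    show "a = b"
    proof (cases a)
      case Zero
      then show ?thesis using ab nz by (cases b) (auto simp: letters_def)
    next
      case a: (Alpha i k)
      show ?thesis
      proof (cases b)
        case Zero
        then show ?thesis using ab nz a by (auto simp: letters_def)
      next
        case b: (Alpha j l)
        have mem: "i \<in> {1..n}" "j \<in> {1..n}" "k \<le> m" "l \<le> m" and eq: "2 ^ k * x i = 2 ^ l * x j"
          using ab a b by (auto simp: letters_def)
        have "i = j" using ne[of i j k l] ne[of j i l k] mem eq by (metis linorder_neqE_nat)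
        then show ?thesis using eq nz[OF mem(1)] a b by auto
      qed
    qed
  qed
  then show "x \<in> {x \<in> topspace (real_space n). inj_on (letter_val x) (letters m n)}" using x by blast
next
  fix x assume "x \<in> {x \<in> topspace (real_space n). inj_on (letter_val x) (letters m n)}"
  then have x: "x \<in> topspace (real_space n)" and inj: "inj_on (letter_val x) (letters m n)" by auto
  have L: "Alpha i k \<in> letters m n" if "i \<in> {1..n}" "k \<le> m" for i k
    using that by (auto simp: letters_def)
  have Z: "Zero \<in> letters m n" by (simp add: letters_def)
  have "x i \<noteq> 0" if "i \<in> {1..n}" for i
    using inj_onD[OF inj _ L[OF that, of 0] Z] by auto
  moreover have "x i \<noteq> 2 powi k * x j"
    if k: "k \<in> {- int m..int m}" and ij: "1 \<le> i" "i < j" "j \<le> n" for i j k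
  proof
    assume eq: "x i = 2 powi k * x j"
    have "2 ^ nat (- k) * x i = 2 ^ nat k * x j"
    proof (cases "k \<ge> 0")
      case True
      then show ?thesis using eq by (simp add: power_int_def)
    next
      case False
      then have "x i = inverse (2 ^ nat (- k)) * x j" using eq by (simp only: power_int_def power_inverse if_False)
      then show ?thesis using False by simp
    qed
    then have "Alpha i (nat (- k)) = Alpha j (nat k)"
      using k ij by (intro inj_onD[OF inj _ L L]) auto
    then show False using ij by simp
  qed
  ultimately have "x \<notin> \<Union> (arrangement m n)" unfolding arrangement_def by blast
  then show "x \<in> topspace (real_space n) - \<Union> (arrangement m n)" using x by blast
qed

lemma ex_sketched_by:
  assumes "finite L" "inj_on (letter_val x) L"
  shows "\<exists>w. set w = L \<and> sketched_by x w"
proof -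
  let ?v = "sorted_list_of_set (letter_val x ` L)"
  let ?w = "map (the_inv_into L (letter_val x)) ?v"
  have v: "set ?v = letter_val x ` L" using assms by simp
  have "set ?w = the_inv_into L (letter_val x) ` letter_val x ` L" unfolding set_map v ..
  also have "\<dots> = L" using assms by (force simp: image_iff the_inv_into_f_f)
  finally have "set ?w = L" .
  moreover have "map (letter_val x) ?w = ?v"
    using assms by (auto simp: f_the_inv_into_f intro!: map_idI)
  then have "sorted_wrt (<) (map (letter_val x) ?w)" by simp
  then have "sketched_by x ?w" by (simp only: sorted_wrt_map)
  ultimately show ?thesis by blast
qed

lemma sketched_by_inj_on:
  assumes "sketched_by x w"
  shows "inj_on (letter_val x) (set w)" "distinct w"
  using assms strict_sorted_iff[of "map (letter_val x) w"]
  by (simp_all add: sorted_wrt_map distinct_map)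

lemma sketched_by_unique:
  assumes "sketched_by x v" "sketched_by x w" "set v = set w"
  shows "v = w"
proof -
  have "map (letter_val x) v = map (letter_val x) w"
    using assms by (intro strict_sorted_equal) (auto simp: sorted_wrt_map)
  then show ?thesis
    using sketched_by_inj_on[OF assms(1)] assms(3) by (simp add: inj_on_map_eq_map)
qed

lemma continuous_map_letter_val:
  assumes "a \<in> letters m n"
  shows "continuous_map (real_space n) euclideanreal (\<lambda>x. letter_val x a)"
proof (cases a)
  case (Alpha i k)
  then have "continuous_map (real_space n) euclideanreal (\<lambda>x. x i)"
    using assms continuous_map_product_projection[of i "{1..n}" "\<lambda>_. euclideanreal"]
    by (auto simp: letters_def)
  then show ?thesis using Alpha by (auto intro!: continuous_intros)
qed simp

lemma openin_cell:
  assumes "set w \<subseteq> letters m n"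
  shows "openin (real_space n) (cell n w)"
  using assms
proof (induction w)
  case Nil
  then show ?case using openin_topspace[of "real_space n"] by (simp add: cell_def del: topspace_product_topology)
next
  case (Cons a w)
  have lt: "openin (real_space n) {x \<in> topspace (real_space n). letter_val x a < letter_val x b}"
    if "b \<in> set w" for b
  proof -
    have "continuous_map (real_space n) euclideanreal (\<lambda>x. letter_val x b - letter_val x a)"
      using Cons.prems that by (intro continuous_intros continuous_map_letter_val) auto
    from openin_continuous_map_preimage[OF this, of "{0<..}"] show ?thesis
      by (simp only: greaterThan_iff diff_gt_0_iff_gt open_openin[symmetric] open_greaterThan simp_thms)
  qed
  have "cell n (a # w) =
      \<Inter> (insert (cell n w) ((\<lambda>b. {x \<in> topspace (real_space n). letter_val x a < letter_val x b}) ` set w))"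
    unfolding cell_def by auto
  also have "openin (real_space n) \<dots>"
    using Cons.IH Cons.prems lt by (intro openin_Inter) auto
  finally show ?case .
qed

text \<open>Letter values are linear in the point, so cells are convex and segments connect them.\<close>

lemma connectedin_cell:
  assumes "set w \<subseteq> letters m n"
  shows "connectedin (real_space n) (cell n w)"
proof (rule path_connectedin_imp_connectedin, unfold path_connectedin, intro conjI ballI)
  show "cell n w \<subseteq> topspace (real_space n)" by (auto simp: cell_def)
  fix x y assume x: "x \<in> cell n w" and y: "y \<in> cell n w"
  define g where "g = (\<lambda>t::real. \<lambda>i\<in>{1..n}. (1 - t) * x i + t * y i)"
  have "pathin (real_space n) g"
    unfolding pathin_def continuous_map_componentwise
  proof (intro conjI ballI)
    fix i assume "i \<in> {1..n}"
    then have "(\<lambda>t. g t i) = (\<lambda>t. (1 - t) * x i + t * y i)" by (simp add: g_def)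
    moreover have "continuous_on {0..1} (\<lambda>t. (1 - t) * x i + t * y i)"
      by (intro continuous_intros)
    ultimately show "continuous_map (top_of_set {0..1}) euclideanreal (\<lambda>t. g t i)"
      by (simp only: continuous_map_iff_continuous)
  qed (auto simp: g_def)
  moreover have val: "letter_val (g t) a = (1 - t) * letter_val x a + t * letter_val y a"
    if "a \<in> set w" for t a
    using that assms by (cases a) (auto simp: g_def letters_def algebra_simps)
  have "g t \<in> cell n w" if t: "t \<in> {0..1}" for t
  proof -
    have "letter_val (g t) a < letter_val (g t) b"
      if ab: "a \<in> set w" "b \<in> set w" "letter_val x a < letter_val x b" "letter_val y a < letter_val y b" for a b
    proof (cases "t = 0")
      case False
      then have "(1 - t) * letter_val x a \<le> (1 - t) * letter_val x b" "t * letter_val y a < t * letter_val y b"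
        using t ab by (auto intro!: mult_left_mono)
      then show ?thesis using val ab by simp
    qed (use val ab in simp)
    then have "sketched_by (g t) w"
      using x y unfolding cell_def sorted_wrt_iff_nth_less by auto
    then show ?thesis by (auto simp: cell_def g_def)
  qed
  moreover have "g 0 = x" "g 1 = y"
    using x y by (auto simp: g_def cell_def PiE_def extensional_def)
  ultimately show "\<exists>g. pathin (real_space n) g \<and> g \<in> {0..1} \<rightarrow> cell n w \<and> g 0 = x \<and> g 1 = y"
    by blast
qed

lemma complement_eq_cells:
  "topspace (real_space n) - \<Union> (arrangement m n) = (\<Union>w\<in>{w. set w = letters m n}. cell n w)"
proof -
  have "inj_on (letter_val x) (letters m n) \<longleftrightarrow> (\<exists>w. set w = letters m n \<and> sketched_by x w)" for x
    using ex_sketched_by[OF finite_letters] sketched_by_inj_on(1) by metis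
  then show ?thesis unfolding complement_arrangement cell_def by blast
qed

text \<open>The cells partition the complement into open sets, hence each of them is also closed
  there; a connected clopen set is a component.\<close>

lemma connected_component_eq_cell:
  assumes w: "set w = letters m n" and x: "x \<in> cell n w"
  shows "connected_component_of_set
     (subtopology (real_space n) (topspace (real_space n) - \<Union> (arrangement m n))) x = cell n w"
    (is "connected_component_of_set ?U x = _")
proof
  have sub: "cell n w \<subseteq> topspace ?U"
    using w unfolding topspace_subtopology complement_eq_cells cell_def by blast
  have "connectedin ?U (cell n w)"
    using connectedin_cell[of w m n] w sub by (simp add: connectedin_subtopology)
  then show "cell n w \<subseteq> connected_component_of_set ?U x"
    using x by (rule connected_component_of_maximal)
  have op: "openin ?U (cell n v)" if "set v = letters m n" for v
    using openin_cell[of v m n] that unfolding openin_subtopology complement_eq_cells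
    by (intro exI[of _ "cell n v"]) auto
  have "topspace ?U - cell n w = (\<Union>v\<in>{v. set v = letters m n \<and> v \<noteq> w}. cell n v)"
    using w sketched_by_unique[of _ w] unfolding topspace_subtopology complement_eq_cells cell_def
    by blast
  moreover have "openin ?U \<dots>" using op by (intro openin_Union) auto
  ultimately have "closedin ?U (cell n w)" using sub by (simp add: closedin_def)
  then have "connected_component_of_set ?U x \<subseteq> cell n w \<or> disjnt (connected_component_of_set ?U x) (cell n w)"
    using op[OF w] connectedin_connected_component_of by (intro connectedin_clopen_cases)
  moreover have "x \<in> connected_component_of_set ?U x"
    using x sub by (auto simp: connected_component_of_refl)
  ultimately show "connected_component_of_set ?U x \<subseteq> cell n w"
    using x by (auto simp: disjnt_iff)
qed

lemma regions_eq_cells: "regions m n = cell n ` sketches m n"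
proof -
  let ?U = "subtopology (real_space n) (topspace (real_space n) - \<Union> (arrangement m n))"
  have top: "topspace ?U = (\<Union>w\<in>sketches m n. cell n w)"
    unfolding topspace_subtopology complement_eq_cells sketches_def cell_def by blast
  have "connected_component_of_set ?U ` cell n w = {cell n w}" if "w \<in> sketches m n" for w
  proof -
    have "set w = letters m n" "cell n w \<noteq> {}" using that by (auto simp: sketches_def)
    then have "connected_component_of_set ?U ` cell n w = (\<lambda>_. cell n w) ` cell n w"
      by (intro image_cong refl connected_component_eq_cell)
    then show ?thesis using \<open>cell n w \<noteq> {}\<close> by (simp add: image_constant_conv)
  qed
  then show ?thesis
    unfolding regions_def connected_components_of_def top image_UN by auto
qed

lemma region_word_cell:
  assumes "w \<in> sketches m n"
  shows "region_word m n (cell n w) = w"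
  unfolding region_word_def
proof (rule the_equality)
  show "distinct w \<and> set w = letters m n \<and> (\<forall>x\<in>cell n w. sketched_by x w)"
    using assms sketched_by_inj_on(2) by (auto simp: sketches_def cell_def)
  fix v assume "distinct v \<and> set v = letters m n \<and> (\<forall>x\<in>cell n w. sketched_by x v)"
  then show "v = w" using assms sketched_by_unique by (auto simp: sketches_def cell_def)
qed

lemma bij_betw_region_word: "bij_betw (region_word m n) (regions m n) (sketches m n)"
  unfolding regions_eq_cells by (rule bij_betwI') (auto simp: region_word_cell)

section \<open>Ladder words and Dyck paths\<close>

text \<open>The pair \<open>(i, k)\<close> is the \<open>k\<close>-th rung of ladder \<open>i\<close>. After taking logarithms of
  absolute values, each side of the origin becomes a set of ladders with unit spacing, placed
  at heights \<open>y i\<close>; a ladder word lists all rungs in increasing order.\<close>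

definition rung_val :: "(nat \<Rightarrow> real) \<Rightarrow> nat \<times> nat \<Rightarrow> real" where
  "rung_val y = (\<lambda>(i, k). y i + real k)"

definition ladder_word :: "nat \<Rightarrow> nat set \<Rightarrow> (nat \<times> nat) list \<Rightarrow> bool" where
  "ladder_word m I u \<longleftrightarrow> set u = I \<times> {0..m} \<and>
     (\<exists>y. sorted_wrt (\<lambda>a b. rung_val y a < rung_val y b) u)"

definition rung_step :: "nat \<times> nat \<Rightarrow> step" where
  "rung_step = (\<lambda>(i, k). if k = 0 then Up i else Down)"

abbreviation height :: "nat \<Rightarrow> step list \<Rightarrow> int" where
  "height m p \<equiv> (\<Sum>s\<leftarrow>p. rise m s)"

abbreviation up_labels :: "step list \<Rightarrow> nat list" where
  "up_labels p \<equiv> map label (filter is_Up p)"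

text \<open>Dyck paths are cut at the marked point, so the labels have to range over arbitrary sets.\<close>

definition dyck_on :: "nat \<Rightarrow> nat set \<Rightarrow> step list \<Rightarrow> bool" where
  "dyck_on m I p \<longleftrightarrow> (\<forall>t\<le>length p. 0 \<le> height m (take t p)) \<and> height m p = 0 \<and>
     distinct (up_labels p) \<and> set (up_labels p) = I"

lemma sorted_wrt_val_distinct:
  fixes f :: "'a \<Rightarrow> 'b::linorder"
  assumes "sorted_wrt (\<lambda>a b. f a < f b) u"
  shows "distinct u"
  using assms by (induction u) auto

lemma sorted_wrt_val_nth:
  fixes f :: "'a \<Rightarrow> 'b::linorder"
  assumes "sorted_wrt (\<lambda>a b. f a < f b) u" "a < length u" "b < length u"
  shows "f (u ! a) < f (u ! b) \<longleftrightarrow> a < b"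
  using assms unfolding sorted_wrt_iff_nth_less
  by (metis linorder_neqE_nat order_less_asym order_less_irrefl)

lemma up_labels_rungs: "up_labels (map rung_step u) = map fst (filter (\<lambda>a. snd a = 0) u)"
  by (induction u) (auto simp: rung_step_def split: if_splits)

lemma height_map_rung_step:
  "height m (map rung_step u) = int ((m + 1) * length (filter (\<lambda>a. snd a = 0) u)) - int (length u)"
  by (induction u) (auto simp: rung_step_def algebra_simps)

lemma distinct_bottom_rungs:
  assumes "distinct u"
  shows "distinct (map fst (filter (\<lambda>a. snd a = 0) u))"
  using assms by (auto simp: distinct_map inj_on_def prod_eq_iff)

text \<open>Each ladder that has been started owes its remaining rungs: its bottom rung contributes
  \<open>+m\<close> and every later one pays back \<open>1\<close>. So the height counts the rungs still owed. This makes
  paths of ladder words nonnegative, and in the other direction tells when a down-step can be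
  read as a rung.\<close>

lemma height_eq_card_missing:
  assumes dist: "distinct u"
    and low: "\<And>i k. (i, k) \<in> set u \<Longrightarrow> k \<le> m \<and> (i, 0) \<in> set u"
  shows "height m (map rung_step u) = int (card ({i. (i, 0) \<in> set u} \<times> {0..m} - set u))"
proof -
  let ?I = "{i. (i, 0) \<in> set u}"
  have I: "?I = set (map fst (filter (\<lambda>a. snd a = 0) u))"
    by (force simp: image_iff)
  have cI: "card ?I = length (filter (\<lambda>a. snd a = 0) u)"
    unfolding I using distinct_card[OF distinct_bottom_rungs[OF dist]] by simp
  have fin: "finite ?I" unfolding I by simp
  have sub: "set u \<subseteq> ?I \<times> {0..m}" using low by auto
  have "card (set u) \<le> card (?I \<times> {0..m})"
    using sub fin by (intro card_mono) auto
  then have "int (card (?I \<times> {0..m} - set u)) = int (card (?I \<times> {0..m})) - int (card (set u))"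
    using sub by (simp add: card_Diff_subset of_nat_diff)
  also have "\<dots> = int ((m + 1) * length (filter (\<lambda>a. snd a = 0) u)) - int (length u)"
    by (simp add: card_cartesian_product cI distinct_card[OF dist] algebra_simps)
  finally show ?thesis unfolding height_map_rung_step by (rule sym)
qed

lemma ladder_word_take_lower:
  assumes u: "set u = I \<times> {0..m}" "sorted_wrt (\<lambda>a b. rung_val y a < rung_val y b) u"
    and mem: "(i, k) \<in> set (take t u)" and "l \<le> k"
  shows "(i, l) \<in> set (take t u)"
proof -
  obtain a where a: "a < t" "a < length u" "u ! a = (i, k)"
    using mem by (auto simp: in_set_conv_nth)
  have "(i, k) \<in> set u" using a by (metis nth_mem)
  then have "(i, l) \<in> set u" using u \<open>l \<le> k\<close> by auto
  then obtain b where b: "b < length u" "u ! b = (i, l)" by (auto simp: in_set_conv_nth)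
  have "\<not> a < b"
    using sorted_wrt_val_nth[OF u(2) a(2) b(1)] a b \<open>l \<le> k\<close> by (auto simp: rung_val_def)
  then have "b < t" using a by auto
  then show ?thesis using b by (auto simp: in_set_conv_nth)
qed

lemma ladder_word_imp_dyck_on:
  assumes "ladder_word m I u"
  shows "dyck_on m I (map rung_step u)"
proof -
  obtain y where u: "set u = I \<times> {0..m}" "sorted_wrt (\<lambda>a b. rung_val y a < rung_val y b) u"
    using assms by (auto simp: ladder_word_def)
  have dist: "distinct u" using u(2) by (rule sorted_wrt_val_distinct)
  have "height m (map rung_step (take t u)) \<ge> 0" for t
  proof -
    have "(i, k) \<in> set (take t u) \<Longrightarrow> k \<le> m \<and> (i, 0) \<in> set (take t u)" for i k
      using ladder_word_take_lower[OF u, of i k t 0] u(1) set_take_subset[of t u] by auto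
    from height_eq_card_missing[OF distinct_take[OF dist] this] show ?thesis by simp
  qed
  moreover have "height m (map rung_step u) = 0"
    using u(1) by (subst height_eq_card_missing[OF dist]) auto
  moreover have "set (map fst (filter (\<lambda>a. snd a = 0) u)) = I"
    using u(1) by (force simp: image_iff)
  ultimately show ?thesis
    using distinct_bottom_rungs[OF dist] by (simp add: dyck_on_def up_labels_rungs take_map)
qed

text \<open>Decoding is forced. Since \<open>(i, k) \<mapsto> (i, k + 1)\<close> preserves the order of the rungs, the
  rungs waiting for their successor are served first in, first out: a down-step must be the
  successor of the earliest waiting rung. Which rungs wait depends only on the word read so far,
  so two ladder words with the same path agree letter by letter.\<close>

lemma map_rung_step_inject:
  assumes "ladder_word m I u" "ladder_word m J v"
    and eq: "map rung_step u = map rung_step v"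
  shows "u = v"
proof -
  obtain y where u: "set u = I \<times> {0..m}" "sorted_wrt (\<lambda>a b. rung_val y a < rung_val y b) u"
    using assms by (auto simp: ladder_word_def)
  obtain z where v: "set v = J \<times> {0..m}" "sorted_wrt (\<lambda>a b. rung_val z a < rung_val z b) v"
    using assms by (auto simp: ladder_word_def)
  have len: "length u = length v" using eq by (metis length_map)
  \<comment> \<open>A down-letter succeeds the earliest waiting rung.\<close>
  have first: "\<exists>a < t. s ! a = (i, k) \<and> (\<forall>b j l. b < t \<longrightarrow> s ! b = (j, l) \<longrightarrow> l < m \<longrightarrow>
         (j, Suc l) \<notin> set (take t s) \<longrightarrow> a \<le> b)"
    if s: "set s = K \<times> {0..m}" "sorted_wrt (\<lambda>a b. rung_val q a < rung_val q b) s"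
      and t: "t < length s" "s ! t = (i, Suc k)" for s K q t i k
  proof -
    have "(i, Suc k) \<in> set s" using t by (metis nth_mem)
    then have "(i, k) \<in> set s" using s by auto
    then obtain a where a: "a < length s" "s ! a = (i, k)" by (auto simp: in_set_conv_nth)
    have "a < t" using sorted_wrt_val_nth[OF s(2) a(1) t(1)] a t by (simp add: rung_val_def)
    moreover have "a \<le> b"
      if b: "b < t" "s ! b = (j, l)" "l < m" "(j, Suc l) \<notin> set (take t s)" for b j l
    proof -
      have bl: "b < length s" using b t by simp
      have "(j, l) \<in> set s" using b bl by (metis nth_mem)
      then have "(j, Suc l) \<in> set s" using s b by auto
      then obtain c where c: "c < length s" "s ! c = (j, Suc l)" by (auto simp: in_set_conv_nth)
      have "\<not> c < t" using b(4) c by (auto simp: in_set_conv_nth)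
      then have "\<not> rung_val q (s ! c) < rung_val q (s ! t)"
        using sorted_wrt_val_nth[OF s(2) c(1) t(1)] by simp
      then have "\<not> rung_val q (s ! b) < rung_val q (s ! a)"
        using a b c t by (simp add: rung_val_def)
      then show ?thesis using sorted_wrt_val_nth[OF s(2) bl a(1)] by simp
    qed
    ultimately show ?thesis using a by auto
  qed
  \<comment> \<open>The rung that a down-letter succeeds was itself waiting.\<close>
  have pending: "l < m \<and> (j, Suc l) \<notin> set (take t s)"
    if s: "set s = K \<times> {0..m}" "sorted_wrt (\<lambda>a b. rung_val q a < rung_val q b) s"
      and t: "t < length s" "s ! t = (j, Suc l)" for s K q t j l
  proof -
    have "(j, Suc l) \<in> set s" using t by (metis nth_mem)
    moreover have "distinct s" using s(2) by (rule sorted_wrt_val_distinct)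
    ultimately show ?thesis
      using s(1) t by (auto simp: in_set_conv_nth) (metis less_trans nth_eq_iff_index_eq order_less_irrefl)
  qed
  have "u ! t = v ! t" if "t < length u" for t
    using that
  proof (induction t rule: less_induct)
    case (less t)
    have tv: "t < length v" using less.prems len by simp
    have tk: "take t u = take t v" using less len by (intro nth_equalityI) auto
    obtain i k j l where uv: "u ! t = (i, k)" "v ! t = (j, l)" by fastforce
    have st: "rung_step (i, k) = rung_step (j, l)"
      using arg_cong[OF eq, of "\<lambda>w. w ! t"] less.prems tv uv by simp
    show ?case
    proof (cases k)
      case 0
      then show ?thesis using st uv by (auto simp: rung_step_def split: if_splits)
    next
      case (Suc k')
      then obtain l' where l': "l = Suc l'"
        using st by (cases l) (auto simp: rung_step_def)
      obtain a where a: "a < t" "u ! a = (i, k')"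
          "\<And>b j l. b < t \<Longrightarrow> u ! b = (j, l) \<Longrightarrow> l < m \<Longrightarrow> (j, Suc l) \<notin> set (take t u) \<Longrightarrow> a \<le> b"
        using first[OF u less.prems, of i k'] uv Suc by blast
      obtain b where b: "b < t" "v ! b = (j, l')"
          "\<And>b' j l. b' < t \<Longrightarrow> v ! b' = (j, l) \<Longrightarrow> l < m \<Longrightarrow> (j, Suc l) \<notin> set (take t v) \<Longrightarrow> b \<le> b'"
        using first[OF v tv, of j l'] uv l' by blast
      have same: "u ! a = v ! a" "u ! b = v ! b" using less a b by auto
      \<comment> \<open>Both words serve the earliest rung of the same waiting set.\<close>
      have "a \<le> b" using a(3)[OF b(1)] b same pending[OF v tv, of j l'] uv l' tk by auto
      moreover have "b \<le> a" using b(3)[OF a(1)] a same pending[OF u less.prems, of i k'] uv Suc tk by auto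
      ultimately show ?thesis using a b same uv Suc l' by auto
    qed
  qed
  then show ?thesis using len by (intro nth_equalityI) auto
qed

lemma finite_imp_bounded_above_below:
  fixes A :: "real set"
  assumes "finite A"
  shows "\<exists>c. \<forall>a\<in>A. a < c" "\<exists>c. \<forall>a\<in>A. c < a"
proof -
  show "\<exists>c. \<forall>a\<in>A. a < c"
    using bdd_above_finite[OF assms] unfolding bdd_above_def by (meson gt_ex le_less_trans)
  show "\<exists>c. \<forall>a\<in>A. c < a"
    using bdd_below_finite[OF assms] unfolding bdd_below_def by (meson lt_ex less_le_trans)
qed

lemma finite_between:
  fixes A B :: "real set"
  assumes "finite A" "finite B" "\<And>a b. a \<in> A \<Longrightarrow> b \<in> B \<Longrightarrow> a < b"
  obtains c where "\<And>a. a \<in> A \<Longrightarrow> a < c" "\<And>b. b \<in> B \<Longrightarrow> c < b"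
proof -
  obtain l u where l: "\<forall>b\<in>B. l < b" and u: "\<forall>a\<in>A. a < u"
    using finite_imp_bounded_above_below[OF assms(1)] finite_imp_bounded_above_below[OF assms(2)] by blast
  consider "A = {}" | "B = {}" | "A \<noteq> {}" "B \<noteq> {}" by blast
  then show ?thesis
  proof cases
    case 1
    then show ?thesis using that[of l] l by blast
  next
    case 2
    then show ?thesis using that[of u] u by blast
  next
    case 3
    then have "Max A < Min B" using assms by simp
    then obtain c where "Max A < c" "c < Min B" using dense by blast
    then show ?thesis using that[of c] assms(1,2) 3 by simp
  qed
qed

text \<open>The invariant of the decoding algorithm: \<open>u\<close> is a possible beginning of a ladder word for
  the positions \<open>y\<close>. The last clause says that no rung which is still owed has been passed. It
  leaves room for a new ladder before the first owed rung and lets this rung come next.\<close>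

definition realizes :: "nat \<Rightarrow> (nat \<Rightarrow> real) \<Rightarrow> (nat \<times> nat) list \<Rightarrow> bool" where
  "realizes m y u \<longleftrightarrow> sorted_wrt (\<lambda>a b. rung_val y a < rung_val y b) u \<and>
     (\<forall>i k. (i, k) \<in> set u \<longrightarrow> k \<le> m \<and> (\<forall>l\<le>k. (i, l) \<in> set u)) \<and>
     (\<forall>i k. (i, k) \<in> set u \<longrightarrow> k < m \<longrightarrow> (i, Suc k) \<notin> set u \<longrightarrow>
        (\<forall>a\<in>set u. rung_val y a < rung_val y (i, Suc k)))"

lemma realizes_height:
  assumes "realizes m y u"
  shows "height m (map rung_step u) = int (card ({i. (i, 0) \<in> set u} \<times> {0..m} - set u))"
  using assms sorted_wrt_val_distinct
  by (intro height_eq_card_missing) (fastforce simp: realizes_def)+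

text \<open>A new ladder is placed strictly between everything read so far and the successors that are
  owed; both are finite sets, separated because of the invariant.\<close>

lemma realizes_snoc_up:
  assumes r: "realizes m y u" and new: "(j, 0) \<notin> set u"
  obtains y' where "realizes m y' (u @ [(j, 0)])"
proof -
  define A where "A = rung_val y ` set u"
  define P where "P = {(i, k). (i, k) \<in> set u \<and> k < m \<and> (i, Suc k) \<notin> set u}"
  define B where "B = (\<lambda>(i, k). rung_val y (i, Suc k)) ` P"
  have "P \<subseteq> set u" by (auto simp: P_def)
  then have fin: "finite A" "finite B" by (auto simp: A_def B_def intro: finite_subset)
  have "a < b" if "a \<in> A" "b \<in> B" for a b
    using r that unfolding A_def B_def P_def realizes_def by auto
  then obtain c where c: "\<And>a. a \<in> A \<Longrightarrow> a < c" "\<And>b. b \<in> B \<Longrightarrow> c < b"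
    using finite_between[OF fin] by metis
  have nj: "i \<noteq> j" if "(i, k) \<in> set u" for i k
    using r that new by (auto simp: realizes_def)
  define y' where "y' = y(j := c)"
  have old: "rung_val y' a = rung_val y a" if "a \<in> set u" for a
    using nj that by (cases a) (auto simp: y'_def rung_val_def)
  have oldS: "rung_val y' (i, Suc k) = rung_val y (i, Suc k)" if "(i, k) \<in> set u" for i k
    using nj that by (auto simp: y'_def rung_val_def)
  have newc: "rung_val y' (j, 0) = c" "rung_val y' (j, Suc 0) = c + 1"
    by (auto simp: y'_def rung_val_def)
  have less: "rung_val y' a < c" if "a \<in> set u" for a
    using c(1) that old by (auto simp: A_def)
  have le: "rung_val y' a \<le> c" if "a \<in> set (u @ [(j, 0)])" for a
    using that less newc(1) by (fastforce simp: less_imp_le)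
  have "sorted_wrt (\<lambda>a b. rung_val y a < rung_val y b) u"
    using r by (simp add: realizes_def)
  then have "sorted_wrt (\<lambda>a b. rung_val y' a < rung_val y' b) u"
    by (rule sorted_wrt_mono_rel[rotated]) (simp add: old)
  then have 1: "sorted_wrt (\<lambda>a b. rung_val y' a < rung_val y' b) (u @ [(j, 0)])"
    using less by (auto simp: sorted_wrt_append newc)
  have 2: "rung_val y' a < rung_val y' (i, Suc k)"
    if p: "(i, k) \<in> set (u @ [(j, 0)])" "k < m" "(i, Suc k) \<notin> set (u @ [(j, 0)])"
      and a: "a \<in> set (u @ [(j, 0)])" for i k a
  proof (cases "(i, k) \<in> set u")
    case True
    then have "rung_val y (i, Suc k) \<in> B" using p by (auto simp: B_def P_def)
    then have "c < rung_val y' (i, Suc k)" using c(2) oldS[OF True] by simp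
    then show ?thesis using le[OF a] by linarith
  next
    case False
    then have "i = j" "k = 0" using p by auto
    then show ?thesis using le[OF a] newc by simp
  qed
  have "realizes m y' (u @ [(j, 0)])"
    unfolding realizes_def using 1 2 r unfolding realizes_def by auto
  then show ?thesis by (rule that)
qed

text \<open>A positive height means that some rung is owed. The successor of the lowest waiting
  rung can be appended without moving any ladder, as it precedes all other owed successors.\<close>

lemma realizes_snoc_down:
  assumes r: "realizes m y u" and pos: "height m (map rung_step u) > 0"
  obtains i k where "realizes m y (u @ [(i, Suc k)])"
proof -
  define P where "P = {(i, k). (i, k) \<in> set u \<and> k < m \<and> (i, Suc k) \<notin> set u}"
  have "P \<subseteq> set u" by (auto simp: P_def)
  then have fin: "finite P" by (auto intro: finite_subset)
  have "{i. (i, 0) \<in> set u} \<times> {0..m} - set u \<noteq> {}"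
    using pos unfolding realizes_height[OF r] by (metis card.empty of_nat_0 order_less_irrefl)
  then obtain i k where ik: "(i, 0) \<in> set u" "k \<le> m" "(i, k) \<notin> set u" by fastforce
  \<comment> \<open>The first gap above a present bottom rung has a waiting rung just below it.\<close>
  define k0 where "k0 = (LEAST k. (i, k) \<notin> set u)"
  have k0: "(i, k0) \<notin> set u" "k0 \<le> k"
    unfolding k0_def using ik(3) by (rule LeastI, rule Least_le)
  then obtain k1 where k1: "k0 = Suc k1" using ik(1) by (cases k0) auto
  have "(i, k1) \<in> set u" using not_less_Least[of k1 "\<lambda>k. (i, k) \<notin> set u"] k1 k0_def by auto
  then have "(i, k1) \<in> P" using k0 k1 ik by (auto simp: P_def)
  then have "P \<noteq> {}" by auto
  then obtain a where a: "a \<in> P" "\<And>b. b \<in> P \<Longrightarrow> rung_val y a \<le> rung_val y b"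
    using arg_min_if_finite[OF fin, of "rung_val y"] by (metis not_le)
  obtain i k where ik: "a = (i, k)" by fastforce
  have inP: "(i, k) \<in> set u" "k < m" "(i, Suc k) \<notin> set u" using a ik by (auto simp: P_def)
  let ?b = "(i, Suc k)"
  have less: "rung_val y c < rung_val y ?b" if "c \<in> set u" for c
    using r inP that unfolding realizes_def by blast
  have s: "sorted_wrt (\<lambda>a b. rung_val y a < rung_val y b) u" using r by (simp add: realizes_def)
  have inj: "rung_val y c \<noteq> rung_val y d" if "c \<in> set u" "d \<in> set u" "c \<noteq> d" for c d
    using that s by (auto simp: in_set_conv_nth) (metis linorder_neqE_nat order_less_irrefl sorted_wrt_val_nth)
  have 1: "sorted_wrt (\<lambda>a b. rung_val y a < rung_val y b) (u @ [?b])"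
    using s less by (auto simp: sorted_wrt_append)
  have 2: "rung_val y c < rung_val y (j, Suc l)"
    if p: "(j, l) \<in> set (u @ [?b])" "l < m" "(j, Suc l) \<notin> set (u @ [?b])"
      and c: "c \<in> set (u @ [?b])" for j l c
  proof -
    have "rung_val y ?b < rung_val y (j, Suc l)"
    proof (cases "(j, l) \<in> set u")
      case True
      then have "(j, l) \<in> P" using p by (auto simp: P_def)
      then have "rung_val y (i, k) \<le> rung_val y (j, l)" using a ik by auto
      moreover have "(i, k) \<noteq> (j, l)" using p by auto
      ultimately have "rung_val y (i, k) < rung_val y (j, l)"
        using inj[OF inP(1) True] by simp
      then show ?thesis by (simp add: rung_val_def)
    next
      case False
      then show ?thesis using p by (auto simp: rung_val_def)
    qed
    then show ?thesis using c less[of c] by fastforce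
  qed
  have 3: "c \<le> m \<and> (\<forall>l\<le>c. (j, l) \<in> set (u @ [?b]))" if "(j, c) \<in> set (u @ [?b])" for j c
    using that r inP by (auto simp: realizes_def le_Suc_eq)
  have "realizes m y (u @ [?b])"
    unfolding realizes_def using 1 2 3 by blast
  then show ?thesis by (rule that)
qed

lemma exists_realizes:
  assumes "\<And>t. t \<le> length p \<Longrightarrow> 0 \<le> height m (take t p)" "distinct (up_labels p)"
  shows "\<exists>y u. realizes m y u \<and> map rung_step u = p"
  using assms
proof (induction p rule: rev_induct)
  case Nil
  then show ?case by (auto simp: realizes_def)
next
  case (snoc s p)
  have "0 \<le> height m (take t p)" if "t \<le> length p" for t
    using snoc.prems(1)[of t] that by simp
  then obtain y u where u: "realizes m y u" "map rung_step u = p"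
    using snoc by auto
  show ?case
  proof (cases s)
    case (Up j)
    have "(j, 0) \<notin> set u"
    proof
      assume "(j, 0) \<in> set u"
      then have "Up j \<in> set p" using u(2) by (force simp: rung_step_def)
      then have "j \<in> set (up_labels p)" by (force simp: image_iff)
      then show False using snoc.prems(2) Up by auto
    qed
    from realizes_snoc_up[OF u(1) this] obtain y' where "realizes m y' (u @ [(j, 0)])" .
    then show ?thesis using u Up by (intro exI[of _ y'] exI[of _ "u @ [(j, 0)]"]) (auto simp: rung_step_def)
  next
    case Down
    have "height m p > 0" using snoc.prems(1)[of "Suc (length p)"] Down by simp
    then obtain i k where "realizes m y (u @ [(i, Suc k)])"
      using realizes_snoc_down[OF u(1)] u(2) by metis
    then show ?thesis using u Down by (intro exI[of _ y] exI[of _ "u @ [(i, Suc k)]"]) (auto simp: rung_step_def)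
  qed
qed

lemma dyck_on_imp_ladder_word:
  assumes "dyck_on m I p"
  obtains u where "ladder_word m I u" "map rung_step u = p"
proof -
  obtain y u where u: "realizes m y u" "map rung_step u = p"
    using assms exists_realizes[of p m] by (auto simp: dyck_on_def)
  have I: "I = {i. (i, 0) \<in> set u}"
    using assms unfolding dyck_on_def u(2)[symmetric] up_labels_rungs by (force simp: image_iff)
  have fin: "finite I" using assms by (auto simp: dyck_on_def)
  have "I \<times> {0..m} - set u = {}"
    using realizes_height[OF u(1)] u(2) assms fin by (simp add: dyck_on_def I)
  moreover have "set u \<subseteq> I \<times> {0..m}"
    using u(1) by (auto simp: realizes_def I)
  ultimately have "ladder_word m I u" using u(1) by (auto simp: ladder_word_def realizes_def)
  then show ?thesis using u(2) that by blast
qed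

section \<open>Words as pairs of ladder words\<close>

text \<open>On the negative side multiplying by \<open>2\<close> decreases the value, so the ladder of \<open>i\<close> starts
  with \<open>Alpha i m\<close> and its rungs are numbered in reverse. With this numbering the bottom rung is
  the letter that becomes an up-step on either side.\<close>

fun pos_letter :: "nat \<times> nat \<Rightarrow> letter" where
  "pos_letter (i, k) = Alpha i k"

fun neg_letter :: "nat \<Rightarrow> nat \<times> nat \<Rightarrow> letter" where
  "neg_letter m (i, k) = Alpha i (m - k)"

definition glue :: "nat \<Rightarrow> (nat \<times> nat) list \<Rightarrow> (nat \<times> nat) list \<Rightarrow> letter list" where
  "glue m u v = map (neg_letter m) u @ Zero # map pos_letter v"

lemma set_glue:
  assumes "I \<subseteq> {1..n}" "set u = I \<times> {0..m}" "set v = ({1..n} - I) \<times> {0..m}"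
  shows "set (glue m u v) = letters m n"
proof -
  have "set (map (neg_letter m) u) = {Alpha i k | i k. i \<in> I \<and> k \<in> {0..m}}"
  proof (intro set_eqI iffI)
    fix a assume "a \<in> {Alpha i k | i k. i \<in> I \<and> k \<in> {0..m}}"
    then obtain i k where a: "a = Alpha i k" "i \<in> I" "k \<le> m" by auto
    then have "a = neg_letter m (i, m - k)" "(i, m - k) \<in> set u" using assms by auto
    then show "a \<in> set (map (neg_letter m) u)" unfolding set_map by (rule image_eqI)
  qed (use assms in auto)
  moreover have "set (map pos_letter v) = {Alpha i k | i k. i \<in> {1..n} - I \<and> k \<in> {0..m}}"
    using assms by (force simp: image_iff)
  ultimately show ?thesis
    using assms(1) by (auto simp del: set_map simp add: glue_def letters_def)
qed

text \<open>Ladder positions become coordinates by exponentiation. The shift by \<open>m\<close> on the negative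
  side accounts for the reversed numbering, so that the value of the letter of a rung \<open>r\<close> is
  \<open>- (2 powr (- rung_val y r))\<close>, which increases with \<open>rung_val y r\<close>.\<close>

lemma glue_in_sketches:
  assumes "I \<subseteq> {1..n}" "ladder_word m I u" "ladder_word m ({1..n} - I) v"
  shows "glue m u v \<in> sketches m n"
proof -
  obtain y where u: "set u = I \<times> {0..m}" "sorted_wrt (\<lambda>a b. rung_val y a < rung_val y b) u"
    using assms by (auto simp: ladder_word_def)
  obtain z where v: "set v = ({1..n} - I) \<times> {0..m}" "sorted_wrt (\<lambda>a b. rung_val z a < rung_val z b) v"
    using assms by (auto simp: ladder_word_def)
  define x where "x = (\<lambda>i\<in>{1..n}. if i \<in> I then - (2 powr (- y i - real m)) else 2 powr z i)"
  have neg: "letter_val x (neg_letter m r) = - (2 powr (- rung_val y r))" if "r \<in> set u" for r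
  proof -
    obtain i k where r: "r = (i, k)" by fastforce
    have ik: "i \<in> I" "k \<le> m" using that u(1) r by auto
    have "2 ^ (m - k) * (2::real) powr (- y i - real m) = 2 powr (real (m - k) + (- y i - real m))"
      by (simp only: powr_add powr_realpow zero_less_numeral)
    also have "real (m - k) + (- y i - real m) = - rung_val y r"
      using ik by (simp add: rung_val_def r of_nat_diff)
    finally show ?thesis using ik assms(1) by (auto simp: x_def r)
  qed
  have pos: "letter_val x (pos_letter r) = 2 powr rung_val z r" if "r \<in> set v" for r
  proof -
    obtain i k where r: "r = (i, k)" by fastforce
    have ik: "i \<in> {1..n} - I" using that v(1) r by auto
    have "2 ^ k * (2::real) powr z i = 2 powr (real k + z i)"
      by (simp only: powr_add powr_realpow zero_less_numeral)
    then show ?thesis using ik by (simp add: x_def r rung_val_def add.commute)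
  qed
  have "sketched_by x (map (neg_letter m) u)"
    unfolding sorted_wrt_map by (rule sorted_wrt_mono_rel[OF _ u(2)]) (simp add: neg)
  moreover have "sketched_by x (map pos_letter v)"
    unfolding sorted_wrt_map by (rule sorted_wrt_mono_rel[OF _ v(2)]) (simp add: pos)
  moreover have lt0: "letter_val x a < 0" if "a \<in> set (map (neg_letter m) u)" for a
    using that neg by auto
  moreover have gt0: "0 < letter_val x a" if "a \<in> set (map pos_letter v)" for a
    using that pos by auto
  moreover have "letter_val x a < letter_val x b"
    if "a \<in> set (map (neg_letter m) u)" "b \<in> set (map pos_letter v)" for a b
    using lt0[OF that(1)] gt0[OF that(2)] by linarith
  ultimately have "sketched_by x (glue m u v)"
    unfolding glue_def sorted_wrt_append sorted_wrt.simps(2) list.set(2) ball_simps(7) letter_val.simps(1)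
    by blast
  moreover have "x \<in> topspace (real_space n)" by (simp add: x_def)
  ultimately have "x \<in> cell n (glue m u v)" by (simp add: cell_def)
  then show ?thesis using set_glue[OF assms(1) u(1) v(1)] by (auto simp: sketches_def)
qed

text \<open>Conversely, the sign of a coordinate decides the side of its whole ladder, and logarithms
  of the absolute values recover the positions.\<close>

lemma sketches_imp_glue:
  assumes "w \<in> sketches m n"
  obtains I u v where "I \<subseteq> {1..n}" "ladder_word m I u" "ladder_word m ({1..n} - I) v" "w = glue m u v"
proof -
  obtain x where w: "set w = letters m n" and x: "sketched_by x w"
    using assms by (auto simp: sketches_def cell_def)
  have "Zero \<in> set w" by (simp add: w letters_def)
  then obtain w1 w2 where w12: "w = w1 @ Zero # w2" by (metis split_list)
  have s1: "sketched_by x w1" and s2: "sketched_by x w2"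
    and n1: "\<And>a. a \<in> set w1 \<Longrightarrow> letter_val x a < 0" and p2: "\<And>a. a \<in> set w2 \<Longrightarrow> 0 < letter_val x a"
    using x by (auto simp: w12 sorted_wrt_append)
  define I where "I = {i \<in> {1..n}. x i < 0}"
  have L: "letters m n = insert Zero (set w1 \<union> set w2)" using w by (auto simp: w12)
  have mem1: "Alpha i k \<in> set w1 \<longleftrightarrow> i \<in> I \<and> k \<le> m" for i k
  proof -
    have "Alpha i k \<in> letters m n \<longleftrightarrow> i \<in> {1..n} \<and> k \<le> m" by (auto simp: letters_def)
    then show ?thesis using n1[of "Alpha i k"] p2[of "Alpha i k"] L
      by (auto simp: I_def mult_less_0_iff zero_less_mult_iff)
  qed
  have mem2: "Alpha i k \<in> set w2 \<longleftrightarrow> i \<in> {1..n} - I \<and> k \<le> m" for i k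
  proof -
    have "Alpha i k \<in> letters m n \<longleftrightarrow> i \<in> {1..n} \<and> k \<le> m" by (auto simp: letters_def)
    then show ?thesis using n1[of "Alpha i k"] p2[of "Alpha i k"] L
      by (auto simp: I_def mult_less_0_iff zero_less_mult_iff)
  qed
  have alpha: "\<exists>i k. a = Alpha i k" if "a \<in> set w1 \<union> set w2" for a
    using that n1[of a] p2[of a] by (cases a) auto
  define neg_rung where "neg_rung = (\<lambda>a. case a of Alpha i k \<Rightarrow> (i, m - k) | Zero \<Rightarrow> (0, 0))"
  define pos_rung where "pos_rung = (\<lambda>a. case a of Alpha i k \<Rightarrow> (i, k) | Zero \<Rightarrow> (0, 0))"
  define y where "y = (\<lambda>i. - log 2 (- x i) - real m)"
  define z where "z = (\<lambda>i. log 2 (x i))"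
  have y: "rung_val y (neg_rung a) = - log 2 (- letter_val x a)" if a: "a \<in> set w1" for a
  proof -
    obtain i k where ik: "a = Alpha i k" using alpha a by blast
    then have "x i < 0" "k \<le> m" using mem1[of i k] a by (auto simp: I_def)
    then have "log 2 (2 ^ k * (- x i)) = real k + log 2 (- x i)"
      by (subst log_mult) (auto simp: log_nat_power)
    then show ?thesis using ik \<open>k \<le> m\<close> by (simp add: y_def rung_val_def neg_rung_def of_nat_diff)
  qed
  have z: "rung_val z (pos_rung a) = log 2 (letter_val x a)" if a: "a \<in> set w2" for a
  proof -
    obtain i k where ik: "a = Alpha i k" using alpha a by blast
    then have "0 < x i" using p2[OF a] by (simp add: zero_less_mult_iff)
    then show ?thesis using ik
      by (simp add: z_def rung_val_def pos_rung_def log_mult log_nat_power)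
  qed
  have "ladder_word m I (map neg_rung w1)"
    unfolding ladder_word_def
  proof (intro conjI exI[of _ y])
    show "set (map neg_rung w1) = I \<times> {0..m}"
    proof (intro set_eqI iffI)
      fix r assume "r \<in> set (map neg_rung w1)"
      then obtain a where "a \<in> set w1" "r = neg_rung a" by auto
      then show "r \<in> I \<times> {0..m}" using alpha[of a] mem1 by (auto simp: neg_rung_def)
    next
      fix r assume "r \<in> I \<times> {0..m}"
      then obtain i k where "r = (i, k)" "i \<in> I" "k \<le> m" by auto
      then have "r = neg_rung (Alpha i (m - k))" "Alpha i (m - k) \<in> set w1"
        using mem1 by (auto simp: neg_rung_def)
      then show "r \<in> set (map neg_rung w1)" by auto
    qed
    show "sorted_wrt (\<lambda>a b. rung_val y a < rung_val y b) (map neg_rung w1)"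
      unfolding sorted_wrt_map by (rule sorted_wrt_mono_rel[OF _ s1]) (simp add: y n1)
  qed
  moreover have "ladder_word m ({1..n} - I) (map pos_rung w2)"
    unfolding ladder_word_def
  proof (intro conjI exI[of _ z])
    show "set (map pos_rung w2) = ({1..n} - I) \<times> {0..m}"
    proof (intro set_eqI iffI)
      fix r assume "r \<in> set (map pos_rung w2)"
      then obtain a where "a \<in> set w2" "r = pos_rung a" by auto
      then show "r \<in> ({1..n} - I) \<times> {0..m}" using alpha[of a] mem2 by (auto simp: pos_rung_def)
    next
      fix r assume "r \<in> ({1..n} - I) \<times> {0..m}"
      then obtain i k where "r = (i, k)" "i \<in> {1..n} - I" "k \<le> m" by auto
      then have "r = pos_rung (Alpha i k)" "Alpha i k \<in> set w2"
        using mem2 by (auto simp: pos_rung_def)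
      then show "r \<in> set (map pos_rung w2)" by auto
    qed
    show "sorted_wrt (\<lambda>a b. rung_val z a < rung_val z b) (map pos_rung w2)"
      unfolding sorted_wrt_map by (rule sorted_wrt_mono_rel[OF _ s2]) (simp add: z p2)
  qed
  moreover have "w = glue m (map neg_rung w1) (map pos_rung w2)"
  proof -
    have "neg_letter m (neg_rung a) = a" if "a \<in> set w1" for a
      using that alpha[of a] mem1 by (auto simp: neg_rung_def)
    moreover have "pos_letter (pos_rung a) = a" if "a \<in> set w2" for a
      using that alpha[of a] by (auto simp: pos_rung_def)
    ultimately show ?thesis by (simp add: glue_def w12 map_idI)
  qed
  moreover have "I \<subseteq> {1..n}" by (auto simp: I_def)
  ultimately show ?thesis using that by blast
qed

section \<open>From words to paths\<close>

definition word_to_path :: "nat \<Rightarrow> letter list \<Rightarrow> step list \<times> (real \<times> real)" where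
  "word_to_path m w =
     (let p1 = map (letter_step m) (left_part w);
          p2 = map (letter_step 0) (right_part w)
      in (p1 @ p2, vertex m (p1 @ p2) (length p1)))"

lemma word_to_path_glue:
  assumes "ladder_word m I u" "ladder_word m J v"
  shows "word_to_path m (glue m u v) =
    (map rung_step u @ map rung_step v, vertex m (map rung_step u @ map rung_step v) (length u))"
proof -
  have nz: "neg_letter m r \<noteq> Zero" for r
    by (cases r) simp
  have "left_part (glue m u v) = map (neg_letter m) u" "right_part (glue m u v) = map pos_letter v"
    unfolding glue_def left_part_def right_part_def
    by (subst takeWhile_append2 dropWhile_append2; auto simp: nz)+
  moreover have "letter_step m (neg_letter m r) = rung_step r" if "r \<in> set u" for r
  proof -
    obtain i k where "r = (i, k)" by fastforce
    then show ?thesis using that assms(1) by (auto simp: ladder_word_def rung_step_def)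
  qed
  then have "map (letter_step m) (map (neg_letter m) u) = map rung_step u" by simp
  moreover have "letter_step 0 (pos_letter r) = rung_step r" for r
    by (cases r) (auto simp: rung_step_def)
  then have "map (letter_step 0) (map pos_letter v) = map rung_step v" by simp
  ultimately show ?thesis by (simp only: word_to_path_def Let_def length_map)
qed

section \<open>Decorated paths as pairs of Dyck paths\<close>

lemma dyck_on_append:
  "dyck_on m K (p @ q) \<and> height m p = 0 \<longleftrightarrow>
     (\<exists>I\<subseteq>K. dyck_on m I p \<and> dyck_on m (K - I) q)"
proof
  assume *: "dyck_on m K (p @ q) \<and> height m p = 0"
  have "0 \<le> height m (take t p)" if "t \<le> length p" for t
    using * that unfolding dyck_on_def by (auto dest: spec[of _ t])
  moreover have "0 \<le> height m (take t q)" if "t \<le> length q" for t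
    using * that unfolding dyck_on_def by (auto dest: spec[of _ "length p + t"])
  ultimately show "\<exists>I\<subseteq>K. dyck_on m I p \<and> dyck_on m (K - I) q"
    using * by (intro exI[of _ "set (up_labels p)"]) (auto simp: dyck_on_def)
next
  assume "\<exists>I\<subseteq>K. dyck_on m I p \<and> dyck_on m (K - I) q"
  then obtain I where I: "I \<subseteq> K" "dyck_on m I p" "dyck_on m (K - I) q" by blast
  have "0 \<le> height m (take t (p @ q))" if "t \<le> length (p @ q)" for t
  proof (cases "t \<le> length p")
    case False
    then show ?thesis using I that by (simp add: dyck_on_def)
  qed (use I in \<open>simp add: dyck_on_def\<close>)
  moreover have "distinct (up_labels (p @ q))" "set (up_labels (p @ q)) = K"
    unfolding filter_append map_append distinct_append set_append
    using I unfolding dyck_on_def by blast+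
  ultimately show "dyck_on m K (p @ q) \<and> height m p = 0"
    using I by (simp add: dyck_on_def)
qed

lemma height_eq_ups_downs:
  "height m p = int m * int (length (filter is_Up p)) - int (length (filter is_Down p))"
proof (induction p)
  case (Cons s p)
  then show ?case by (cases s) (auto simp: algebra_simps)
qed simp

lemma labeled_dyck_path_iff_dyck_on: "labeled_dyck_path m n p \<longleftrightarrow> dyck_on m {1..n} p"
proof
  assume p: "labeled_dyck_path m n p"
  then have "card (set (up_labels p)) = n"
    by (simp only: labeled_dyck_path_def distinct_card length_map)
  then have "set (up_labels p) = {1..n}"
    using p by (intro card_subset_eq) (auto simp: labeled_dyck_path_def)
  then show "dyck_on m {1..n} p"
    using p height_eq_ups_downs[of m p] by (simp add: dyck_on_def labeled_dyck_path_def)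
next
  assume p: "dyck_on m {1..n} p"
  then have "length (up_labels p) = n"
    using distinct_card[of "up_labels p"] by (simp add: dyck_on_def)
  then have u: "length (filter is_Up p) = n" by simp
  moreover from this have d: "length (filter is_Down p) = m * n"
    using height_eq_ups_downs[of m p] p unfolding dyck_on_def
    by (metis eq_iff_diff_eq_0 of_nat_eq_iff of_nat_mult)
  moreover have "is_Down = (\<lambda>s. \<not> is_Up s)"
  proof
    show "is_Down s \<longleftrightarrow> \<not> is_Up s" for s by (cases s) simp_all
  qed
  then have "length p = (m + 1) * n"
    using sum_length_filter_compl[of is_Up p] u d by simp
  ultimately show "labeled_dyck_path m n p" using p by (simp add: dyck_on_def labeled_dyck_path_def)
qed

text \<open>The marked point is given as a point of the plane. It must be a vertex: inside a segment the
  height is a proper convex combination of two nonnegative numbers, which differ because an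
  up-step has \<open>m \<ge> 1\<close>, so it is positive.\<close>

lemma drawing_meets_axis:
  assumes "m \<ge> 1" and nonneg: "\<And>t. t \<le> length p \<Longrightarrow> 0 \<le> height m (take t p)"
  shows "P \<in> drawing m p \<and> snd P = 0 \<longleftrightarrow>
     (\<exists>t\<le>length p. P = vertex m p t \<and> height m (take t p) = 0)"
proof
  assume P: "P \<in> drawing m p \<and> snd P = 0"
  show "\<exists>t\<le>length p. P = vertex m p t \<and> height m (take t p) = 0"
  proof (cases "P = (0, 0)")
    case True
    then show ?thesis by (intro exI[of _ 0]) (simp add: vertex_def)
  next
    case False
    then obtain t where t: "t < length p" "P \<in> closed_segment (vertex m p t) (vertex m p (Suc t))"
      using P by (auto simp: drawing_def)
    then obtain u where u: "0 \<le> u" "u \<le> 1" "P = (1 - u) *\<^sub>R vertex m p t + u *\<^sub>R vertex m p (Suc t)"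
      by (auto simp: in_segment)
    define a b where "a = height m (take t p)" and "b = height m (take (Suc t) p)"
    have "0 \<le> a" "0 \<le> b" using nonneg[of t] nonneg[of "Suc t"] t by (auto simp: a_def b_def)
    have "b = a + rise m (p ! t)" using t by (simp add: a_def b_def take_Suc_conv_app_nth)
    then have "a \<noteq> b" using \<open>m \<ge> 1\<close> by (cases "p ! t") auto
    have eq: "(1 - u) * a + u * b = 0" using P u(3) by (simp add: vertex_def a_def b_def)
    have "(1 - u) * a \<ge> 0" "u * b \<ge> 0" using u \<open>0 \<le> a\<close> \<open>0 \<le> b\<close> by auto
    then have "(1 - u) * a = 0" "u * b = 0" using eq by linarith+
    then consider "u = 0" "a = 0" | "u = 1" "b = 0" using \<open>a \<noteq> b\<close> by auto
    then show ?thesis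
    proof cases
      case 1
      then show ?thesis using t u by (intro exI[of _ t]) (simp add: a_def)
    next
      case 2
      then show ?thesis using t u by (intro exI[of _ "Suc t"]) (simp add: b_def)
    qed
  qed
next
  assume "\<exists>t\<le>length p. P = vertex m p t \<and> height m (take t p) = 0"
  then obtain t where t: "t \<le> length p" "P = vertex m p t" "height m (take t p) = 0" by blast
  have "P \<in> drawing m p"
  proof (cases t)
    case 0
    then show ?thesis using t by (simp add: drawing_def vertex_def)
  next
    case (Suc s)
    then have "P \<in> closed_segment (vertex m p s) (vertex m p (Suc s))" using t by simp
    then show ?thesis using t Suc by (auto simp: drawing_def)
  qed
  then show "P \<in> drawing m p \<and> snd P = 0" using t by (simp add: vertex_def)
qed

lemma decorated_dyck_paths_eq:
  assumes "m \<ge> 1"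
  shows "decorated_dyck_paths m n =
    {(p @ q, vertex m (p @ q) (length p)) | p q I.
       I \<subseteq> {1..n} \<and> dyck_on m I p \<and> dyck_on m ({1..n} - I) q}" (is "_ = ?R")
proof -
  have iff: "(p, P) \<in> decorated_dyck_paths m n \<longleftrightarrow>
      dyck_on m {1..n} p \<and> (\<exists>t\<le>length p. P = vertex m p t \<and> height m (take t p) = 0)" for p P
    using drawing_meets_axis[OF assms, of p P]
    by (auto simp: decorated_dyck_paths_def labeled_dyck_path_iff_dyck_on dyck_on_def)
  show ?thesis
  proof (intro set_eqI iffI)
    fix d assume "d \<in> decorated_dyck_paths m n"
    then obtain p t where d: "d = (p, vertex m p t)" "dyck_on m {1..n} p" "t \<le> length p" "height m (take t p) = 0"
      using iff by (metis surj_pair)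
    have "dyck_on m {1..n} (take t p @ drop t p) \<and> height m (take t p) = 0" using d by simp
    then obtain I where I: "I \<subseteq> {1..n}" "dyck_on m I (take t p)" "dyck_on m ({1..n} - I) (drop t p)"
      unfolding dyck_on_append by blast
    moreover have "d = (take t p @ drop t p, vertex m (take t p @ drop t p) (length (take t p)))"
      using d by simp
    ultimately show "d \<in> ?R" by blast
  next
    fix d assume "d \<in> ?R"
    then obtain p q I where d: "d = (p @ q, vertex m (p @ q) (length p))"
      and "I \<subseteq> {1..n}" "dyck_on m I p" "dyck_on m ({1..n} - I) q" by blast
    then have "dyck_on m {1..n} (p @ q) \<and> height m p = 0" unfolding dyck_on_append by blast
    then show "d \<in> decorated_dyck_paths m n"
      unfolding d iff by (intro conjI exI[of _ "length p"]) auto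
  qed
qed

section \<open>The bijection\<close>

lemma bij_betw_word_to_path:
  assumes "m \<ge> 1"
  shows "bij_betw (word_to_path m) (sketches m n) (decorated_dyck_paths m n)"
proof (rule bij_betwI')
  fix w w' assume "w \<in> sketches m n" "w' \<in> sketches m n"
  then obtain I u v J u' v' where uv: "ladder_word m I u" "ladder_word m ({1..n} - I) v" "w = glue m u v"
    and uv': "ladder_word m J u'" "ladder_word m ({1..n} - J) v'" "w' = glue m u' v'"
    by (metis sketches_imp_glue)
  show "word_to_path m w = word_to_path m w' \<longleftrightarrow> w = w'"
  proof
    assume "word_to_path m w = word_to_path m w'"
    then have app: "map rung_step u @ map rung_step v = map rung_step u' @ map rung_step v'"
      and "length u = length u'"
      unfolding uv(3) uv'(3) word_to_path_glue[OF uv(1,2)] word_to_path_glue[OF uv'(1,2)]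
      by (auto simp: vertex_def)
    then have "map rung_step u = map rung_step u'" "map rung_step v = map rung_step v'" by auto
    then have "u = u'" "v = v'"
      using map_rung_step_inject uv uv' by blast+
    then show "w = w'" using uv uv' by simp
  qed simp
next
  fix w assume "w \<in> sketches m n"
  then obtain I u v where uv: "I \<subseteq> {1..n}" "ladder_word m I u" "ladder_word m ({1..n} - I) v" "w = glue m u v"
    by (rule sketches_imp_glue)
  have "dyck_on m I (map rung_step u)" "dyck_on m ({1..n} - I) (map rung_step v)"
    using uv by (auto intro: ladder_word_imp_dyck_on)
  moreover have "word_to_path m w = (map rung_step u @ map rung_step v,
      vertex m (map rung_step u @ map rung_step v) (length (map rung_step u)))"
    using word_to_path_glue[OF uv(2,3)] uv(4) by simp
  ultimately show "word_to_path m w \<in> decorated_dyck_paths m n"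
    unfolding decorated_dyck_paths_eq[OF assms] using uv(1) by blast
next
  fix d assume "d \<in> decorated_dyck_paths m n"
  then obtain p q I where d: "d = (p @ q, vertex m (p @ q) (length p))"
    and I: "I \<subseteq> {1..n}" "dyck_on m I p" "dyck_on m ({1..n} - I) q"
    unfolding decorated_dyck_paths_eq[OF assms] by blast
  obtain u where u: "ladder_word m I u" "map rung_step u = p"
    using I(2) by (rule dyck_on_imp_ladder_word)
  obtain v where v: "ladder_word m ({1..n} - I) v" "map rung_step v = q"
    using I(3) by (rule dyck_on_imp_ladder_word)
  have "d = word_to_path m (glue m u v)"
    using word_to_path_glue[OF u(1) v(1)] u(2) v(2) d by auto
  then show "\<exists>w\<in>sketches m n. d = word_to_path m w"
    using glue_in_sketches[OF I(1) u(1) v(1)] by blast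
qed

theorem mainTheorem7:
  fixes m n :: nat
  assumes "m \<ge> 1" and "n \<ge> 1"
  shows "bij_betw (region_to_path m n) (regions m n) (decorated_dyck_paths m n)"
proof -
  have "region_to_path m n = word_to_path m \<circ> region_word m n"
    by (simp add: fun_eq_iff region_to_path_def word_to_path_def Let_def)
  then show ?thesis
    using bij_betw_trans[OF bij_betw_region_word bij_betw_word_to_path[OF assms(1)]] by simp
qed

end
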